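(* Let $k, \ell \ge 1$ be fixed integers. If $G$ is a graph containing a clique of order $k$, then \[ \mathscr{I}(G) \le \frac{\alpha(G^{\Box \ell}\Box K_k)}{k|V(G)|^{\ell}}.\] Moreover, \[ \mathscr{I}(G) = \lim_{\ell \rightarrow \infty}\frac{\alpha(G^{\Box \ell}\Box K_k)}{k|V(G)|^{\ell}}.\]
   Context: All graphs are finite and simple. The Cartesian product $G \Box H$ has vertex set $V(G)\times V(H)$, with $(u,x)$ adjacent to $(v,y)$ if and only if either $u=v$ and $xy\in E(H)$, or $x=y$ and $uv\in E(G)$. Set $G^{\Box 1}=G$ and $G^{\Box k}=G^{\Box (k-1)}\Box G$ for $k\ge 2$. $\alpha(G)$ is the independence number of $G$, and $K_k$ is the complete graph on $k$ vertices. A clique of order $k$ is a set of $k$ pairwise adjacent vertices. The independence ratio is $i(G)=\alpha(G)/|V(G)|$, and the ultimate independence ratio is $\mathscr{I}(G)=\lim_{m\to\infty} i(G^{\Box m})$; this limit exists because $i(G^{\Box (m+1)})\le i(G^{\Box m})$ for all $m$. *)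

theory Defs
  imports Complex_Main "Graph_Theory.Graph_Theory"
begin

text \<open>
  Finite simple graphs are the loop-free symmetric digraphs without parallel arcs of
  \<^locale>\<open>pair_graph\<close>: an edge \<open>uv\<close> is represented by the two arcs \<open>(u, v)\<close> and \<open>(v, u)\<close>.
\<close>

definition cart_prod :: "'a pair_pre_digraph \<Rightarrow> 'b pair_pre_digraph \<Rightarrow> ('a \<times> 'b) pair_pre_digraph"
    (infixl \<open>\<box>\<close> 70) where
  "G \<box> H = \<lparr> pverts = pverts G \<times> pverts H,
     parcs = {((u, x), (v, y)).
       u \<in> pverts G \<and> v \<in> pverts G \<and> x \<in> pverts H \<and> y \<in> pverts H \<and>
       (u = v \<and> (x, y) \<in> parcs H \<or> x = y \<and> (u, v) \<in> parcs G)} \<rparr>"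

definition relabel :: "('a \<Rightarrow> 'b) \<Rightarrow> 'a pair_pre_digraph \<Rightarrow> 'b pair_pre_digraph" where
  "relabel f G = \<lparr> pverts = f ` pverts G, parcs = map_prod f f ` parcs G \<rparr>"

text \<open>
  The iterated product \<open>(\<dots>(G \<box> G) \<box> \<dots>) \<box> G\<close> has a vertex type that depends on the number of
  factors. Its vertices, left-nested tuples, are therefore flattened to lists: the vertex
  \<open>(xs, x)\<close> of \<open>cart_power G k \<box> G\<close> becomes \<open>xs @ [x]\<close>. The power with exponent 0 is the
  one-vertex graph, so that the power with exponent 1 is \<open>G\<close> with \<open>x\<close> renamed to \<open>[x]\<close>
  (lemma \<open>cart_power_1\<close> below).
\<close>

primrec cart_power :: "'a pair_pre_digraph \<Rightarrow> nat \<Rightarrow> 'a list pair_pre_digraph" where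
  "cart_power G 0 = \<lparr> pverts = {[]}, parcs = {} \<rparr>"
| "cart_power G (Suc k) = relabel (\<lambda>(xs, x). xs @ [x]) (cart_power G k \<box> G)"

definition complete_graph :: "nat \<Rightarrow> nat pair_pre_digraph" where
  "complete_graph k = \<lparr> pverts = {..<k}, parcs = {(i, j). i < k \<and> j < k \<and> i \<noteq> j} \<rparr>"

definition is_clique :: "'a pair_pre_digraph \<Rightarrow> 'a set \<Rightarrow> bool" where
  "is_clique G S \<longleftrightarrow> S \<subseteq> pverts G \<and> (\<forall>u\<in>S. \<forall>v\<in>S. u \<noteq> v \<longrightarrow> (u, v) \<in> parcs G)"

definition independent_set :: "'a pair_pre_digraph \<Rightarrow> 'a set \<Rightarrow> bool" where
  "independent_set G S \<longleftrightarrow> S \<subseteq> pverts G \<and> (\<forall>u\<in>S. \<forall>v\<in>S. (u, v) \<notin> parcs G)"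

definition independence_number :: "'a pair_pre_digraph \<Rightarrow> nat" where
  "independence_number G = Max (card ` {S. independent_set G S})"

definition independence_ratio :: "'a pair_pre_digraph \<Rightarrow> real" where
  "independence_ratio G = real (independence_number G) / real (card (pverts G))"

text \<open>The limit exists for every finite simple graph: see \<open>independence_ratio_convergent\<close> below.\<close>

definition ultimate_independence_ratio :: "'a pair_pre_digraph \<Rightarrow> real" where
  "ultimate_independence_ratio G = lim (\<lambda>m. independence_ratio (cart_power G m))"


lemma cart_prod_simps [simp]:
  "pverts (G \<box> H) = pverts G \<times> pverts H"
  "((u, x), (v, y)) \<in> parcs (G \<box> H) \<longleftrightarrow>
     u \<in> pverts G \<and> v \<in> pverts G \<and> x \<in> pverts H \<and> y \<in> pverts H \<and>
     (u = v \<and> (x, y) \<in> parcs H \<or> x = y \<and> (u, v) \<in> parcs G)"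
  by (auto simp: cart_prod_def)

lemma pair_graph_cart_prod:
  assumes "pair_graph G" "pair_graph H"
  shows "pair_graph (G \<box> H)"
proof -
  interpret G: pair_graph G by fact
  interpret H: pair_graph H by fact
  have "parcs (G \<box> H) \<subseteq> pverts (G \<box> H) \<times> pverts (G \<box> H)"
    by (auto simp: cart_prod_def)
  then have "finite (parcs (G \<box> H))"
    by (rule finite_subset) (simp add: G.pair_finite_verts H.pair_finite_verts)
  moreover have "symmetric (with_proj (G \<box> H))"
    using G.arcs_symmetric H.arcs_symmetric
    by (auto simp: symmetric_def sym_def)
  ultimately show ?thesis
    using G.pair_no_loops H.pair_no_loops
    by unfold_locales (auto simp: G.pair_finite_verts H.pair_finite_verts, auto simp: cart_prod_def)
qed

lemma complete_graph_is_complete: "K\<^bsub>k\<^esub> (with_proj (complete_graph k))"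
  by (auto simp: complete_digraph_pair_def complete_graph_def)

lemma cart_power_1: "pair_graph G \<Longrightarrow> cart_power G 1 = relabel (\<lambda>x. [x]) G"
proof -
  assume "pair_graph G"
  then interpret pair_graph G .
  have "parcs (relabel (\<lambda>(xs, x). xs @ [x]) (\<lparr>pverts = {[]}, parcs = {}\<rparr> \<box> G))
        = parcs (relabel (\<lambda>x. [x]) G)"
    by (auto simp: relabel_def cart_prod_def image_def map_prod_def split: prod.splits
             dest: in_arcsD1 in_arcsD2)
  moreover have "pverts (relabel (\<lambda>(xs, x). xs @ [x]) (\<lparr>pverts = {[]}, parcs = {}\<rparr> \<box> G))
        = pverts (relabel (\<lambda>x. [x]) G)"
    by (force simp: relabel_def)
  ultimately show ?thesis
    by simp
qed

lemma inj_snoc: "inj (\<lambda>(xs, x). xs @ [x])"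
  by (auto simp: inj_def)

lemma pair_graph_relabel:
  assumes "pair_graph G" "inj f"
  shows "pair_graph (relabel f G)"
proof -
  interpret pair_graph G by fact
  show ?thesis
    using pair_no_loops arcs_symmetric \<open>inj f\<close>
    by unfold_locales
       (auto simp: relabel_def symmetric_def sym_def pair_finite_verts pair_finite_arcs inj_eq
             dest: in_arcsD1 in_arcsD2)
qed

lemma pair_graph_cart_power:
  assumes "pair_graph G"
  shows "pair_graph (cart_power G k)"
proof (induction k)
  case 0
  show ?case
    by unfold_locales (auto simp: symmetric_def sym_def)
next
  case (Suc k)
  then show ?case
    using assms by (auto intro!: pair_graph_relabel pair_graph_cart_prod inj_snoc)
qed

lemma card_cart_power: "card (pverts (cart_power G k)) = card (pverts G) ^ k"
proof (induction k)
  case (Suc k)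
  have "card (pverts (cart_power G (Suc k))) = card (pverts (cart_power G k \<box> G))"
    by (simp add: relabel_def card_image inj_on_subset [OF inj_snoc])
  with Suc show ?case
    by (simp add: card_cartesian_product)
qed simp

lemma finite_independent_sets: "finite (pverts G) \<Longrightarrow> finite {S. independent_set G S}"
  by (rule finite_subset [of _ "Pow (pverts G)"]) (auto simp: independent_set_def)

lemma independence_number_ge:
  "finite (pverts G) \<Longrightarrow> independent_set G S \<Longrightarrow> card S \<le> independence_number G"
  by (auto simp: independence_number_def finite_independent_sets intro!: Max_ge)

lemma independence_number_attained:
  assumes "finite (pverts G)"
  obtains S where "independent_set G S" "card S = independence_number G"
proof -
  have "card ` {S. independent_set G S} \<noteq> {}"
    by (auto simp: independent_set_def)
  then have "independence_number G \<in> card ` {S. independent_set G S}"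
    unfolding independence_number_def
    using assms by (intro Max_in finite_imageI finite_independent_sets)
  then show ?thesis
    using that by auto
qed

lemma independence_number_relabel:
  assumes "inj f"
  shows "independence_number (relabel f G) = independence_number G"
proof -
  have "{S. independent_set (relabel f G) S} = image f ` {S. independent_set G S}"
  proof (intro equalityI subsetI)
    fix S assume S: "S \<in> {S. independent_set (relabel f G) S}"
    then obtain T where T: "T \<subseteq> pverts G" "S = f ` T"
      by (auto simp: independent_set_def relabel_def subset_image_iff)
    with S have "independent_set G T"
      by (force simp: independent_set_def relabel_def)
    with T show "S \<in> image f ` {S. independent_set G S}"
      by auto
  next
    fix S assume "S \<in> image f ` {S. independent_set G S}"
    with assms show "S \<in> {S. independent_set (relabel f G) S}"
      by (auto simp: independent_set_def relabel_def inj_eq)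
  qed
  moreover have "card (f ` S) = card S" for S
    using assms by (simp add: card_image inj_on_subset)
  ultimately show ?thesis
    by (simp add: independence_number_def image_image)
qed

lemma independence_number_cart_prod_le:
  assumes G: "finite (pverts G)" and H: "finite (pverts H)"
  shows "independence_number (G \<box> H) \<le> independence_number G * card (pverts H)"
proof -
  have "finite (pverts (G \<box> H))"
    using assms by simp
  then obtain S where S: "independent_set (G \<box> H) S" "card S = independence_number (G \<box> H)"
    by (rule independence_number_attained)
  define T where "T x = {u. (u, x) \<in> S}" for x
  have sub: "S \<subseteq> pverts G \<times> pverts H"
    using S by (auto simp: independent_set_def)
  have ind: "independent_set G (T x)" for x
    using S(1) unfolding independent_set_def T_def by fastforce
  have "S = (\<Union>x\<in>pverts H. T x \<times> {x})"
    using sub by (auto simp: T_def)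
  then have "card S \<le> (\<Sum>x\<in>pverts H. card (T x \<times> {x}))"
    using card_UN_le [OF H] by metis
  also have "\<dots> = (\<Sum>x\<in>pverts H. card (T x))"
    by (simp add: card_cartesian_product)
  also have "\<dots> \<le> (\<Sum>x\<in>pverts H. independence_number G)"
    by (intro sum_mono independence_number_ge G ind)
  finally show ?thesis
    using S(2) by (simp add: mult.commute)
qed

lemma independence_ratio_antimono:
  assumes "pair_graph G"
  shows "independence_ratio (cart_power G (Suc m)) \<le> independence_ratio (cart_power G m)"
proof (cases "card (pverts G) = 0")
  case True
  then show ?thesis
    by (simp add: independence_ratio_def card_cart_power del: cart_power.simps)
next
  case False
  interpret G: pair_graph G by fact
  interpret P: pair_graph "cart_power G m" by (rule pair_graph_cart_power) fact
  have "independence_number (cart_power G (Suc m))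
          \<le> independence_number (cart_power G m) * card (pverts G)"
    using independence_number_cart_prod_le [OF P.pair_finite_verts G.pair_finite_verts]
    by (simp add: independence_number_relabel inj_snoc)
  then have "real (independence_number (cart_power G (Suc m)))
          \<le> real (independence_number (cart_power G m)) * real (card (pverts G))"
    by (metis of_nat_le_iff of_nat_mult)
  moreover have "real (card (pverts G)) > 0"
    using False by linarith
  ultimately show ?thesis
    by (simp add: independence_ratio_def card_cart_power divide_simps mult.commute
             del: cart_power.simps card_gt_0_iff of_nat_0_less_iff)
qed

lemma independence_ratio_convergent:
  assumes "pair_graph G"
  shows "convergent (\<lambda>m. independence_ratio (cart_power G m))"
proof -
  have "decseq (\<lambda>m. independence_ratio (cart_power G m))"
    using independence_ratio_antimono [OF assms] by (intro decseq_SucI)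
  moreover have "0 \<le> independence_ratio (cart_power G m)" for m
    by (simp add: independence_ratio_def)
  ultimately obtain L where "(\<lambda>m. independence_ratio (cart_power G m)) \<longlonglongrightarrow> L"
    using decseq_convergent by blast
  then show ?thesis
    by (rule convergentI)
qed

end

theory Submission
  imports Defs
begin

text \<open>
  Write \<open>n\<close> for the order of \<open>G\<close>, \<open>i m\<close> for the independence ratio of \<open>cart_power G m\<close> and
  \<open>a m\<close> for that of \<open>cart_power G m \<box> complete_graph k\<close>. Slicing an independent set of
  \<open>H \<box> G\<close> along the \<open>k\<close>-clique and the \<open>n - k\<close> remaining vertices of \<open>G\<close> gives
  \<open>\<alpha>(H \<box> G) \<le> \<alpha>(H \<box> K\<^sub>k) + (n - k) \<alpha>(H)\<close>. For \<open>H = cart_power G m\<close> this reads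
  \<open>i (m + 1) \<le> (k / n) a m + (1 - k / n) i m\<close>, that is,
  \<open>i m - (n / k) (i m - i (m + 1)) \<le> a m\<close>. Together with \<open>a m \<le> i m\<close> this squeezes \<open>a\<close>
  to the limit of \<open>i\<close>, and since \<open>a\<close> is decreasing it stays above its limit.
\<close>

text \<open>The preimage of \<open>S\<close> under the homomorphism \<open>f\<close> is independent
  in \<open>H\<close>, and \<open>f\<close> maps it onto the part of \<open>S\<close> inside the
  image. Below, \<open>f\<close> embeds one layer, or a block of layers, into a product.\<close>

lemma card_independent_set_Int_image_le:
  assumes S: "independent_set G S"
    and fin: "finite (pverts H)"
    and hom: "\<And>u v. u \<in> pverts H \<Longrightarrow> v \<in> pverts H \<Longrightarrow> (u, v) \<in> parcs H \<Longrightarrow> (f u, f v) \<in> parcs G"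
  shows "card (S \<inter> f ` pverts H) \<le> independence_number H"
proof -
  let ?T = "{v \<in> pverts H. f v \<in> S}"
  have "independent_set H ?T"
    using S hom unfolding independent_set_def by blast
  have "S \<inter> f ` pverts H = f ` ?T"
    by auto
  then have "card (S \<inter> f ` pverts H) \<le> card ?T"
    using fin by (simp add: card_image_le)
  also have "\<dots> \<le> independence_number H"
    by (rule independence_number_ge) fact+
  finally show ?thesis .
qed

lemma independence_number_cart_prod_clique_le:
  assumes H: "finite (pverts H)" and G: "finite (pverts G)"
    and C: "is_clique G C" "card C = k"
  shows "independence_number (H \<box> G)
    \<le> independence_number (H \<box> complete_graph k) + (card (pverts G) - k) * independence_number H"
proof -
  have sub: "C \<subseteq> pverts G" and adj: "\<And>u v. u \<in> C \<Longrightarrow> v \<in> C \<Longrightarrow> u \<noteq> v \<Longrightarrow> (u, v) \<in> parcs G"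
    using C by (auto simp: is_clique_def)
  have "finite C"
    using sub G by (rule finite_subset)
  \<comment> \<open>The vertices of \<open>complete_graph k\<close> are the numbers below
    \<open>k\<close>, so an enumeration \<open>g\<close> of the clique makes
    \<open>map_prod id g\<close> an embedding onto the layers over \<open>C\<close>.\<close>
  then obtain g where g: "bij_betw g {..<k} C"
    using ex_bij_betw_nat_finite C(2) by (metis atLeast0LessThan)
  have gC: "g i \<in> C" if "i < k" for i
    using g that by (auto simp: bij_betw_def)
  \<comment> \<open>A clique makes only distinct vertices adjacent, so injectivity is what carries
    edges of \<open>complete_graph k\<close> to edges of \<open>G\<close>.\<close>
  have g_neq: "g i \<noteq> g j" if "i < k" "j < k" "i \<noteq> j" for i j
    using g that by (auto simp: bij_betw_def inj_on_def)
  have "finite (pverts (H \<box> G))"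
    using H G by simp
  then obtain S where S: "independent_set (H \<box> G) S" "card S = independence_number (H \<box> G)"
    by (rule independence_number_attained)
  let ?K = "map_prod id g ` pverts (H \<box> complete_graph k)"
  have "S \<subseteq> pverts H \<times> pverts G"
    using S by (simp add: independent_set_def)
  moreover have "?K = pverts H \<times> C"
    using g by (simp add: complete_graph_def bij_betw_def map_prod_surj_on)
  ultimately have S_eq: "S = (S \<inter> ?K) \<union> (\<Union>x\<in>pverts G - C. S \<inter> (\<lambda>u. (u, x)) ` pverts H)"
    by (fastforce simp del: cart_prod_simps)
  have "card (S \<inter> ?K) \<le> independence_number (H \<box> complete_graph k)"
    using subsetD [OF sub gC] gC adj g_neq
    by (intro card_independent_set_Int_image_le [OF S(1)])
       (auto simp: H complete_graph_def)
  moreover have "card (\<Union>x\<in>pverts G - C. S \<inter> (\<lambda>u. (u, x)) ` pverts H)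
      \<le> (\<Sum>x\<in>pverts G - C. card (S \<inter> (\<lambda>u. (u, x)) ` pverts H))"
    using G by (intro card_UN_le) simp
  moreover have "\<dots> \<le> (\<Sum>x\<in>pverts G - C. independence_number H)"
    by (intro sum_mono card_independent_set_Int_image_le [OF S(1)]) (auto simp: H)
  moreover have "card (pverts G - C) = card (pverts G) - k"
    using sub \<open>finite C\<close> C(2) by (simp add: card_Diff_subset)
  moreover have "card S \<le> card (S \<inter> ?K)
      + card (\<Union>x\<in>pverts G - C. S \<inter> (\<lambda>u. (u, x)) ` pverts H)"
    by (subst S_eq) (rule card_Un_le)
  ultimately show ?thesis
    using S(2) by simp
qed

text \<open>Fixing the last list entry \<open>x\<close> cuts the product into one copy of
  \<open>cart_power G m \<box> H\<close> for each vertex \<open>x\<close> of \<open>G\<close>. With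
  \<open>H\<close> complete, this makes the sequence \<open>a\<close> of the theorem
  decreasing.\<close>

lemma independence_number_cart_power_Suc_cart_prod_le:
  assumes G: "finite (pverts G)" and P: "finite (pverts (cart_power G m))"
    and H: "finite (pverts H)"
  shows "independence_number (cart_power G (Suc m) \<box> H)
    \<le> card (pverts G) * independence_number (cart_power G m \<box> H)"
proof -
  let ?P = "cart_power G (Suc m) \<box> H" and ?Q = "cart_power G m \<box> H"
  let ?f = "\<lambda>x. map_prod (\<lambda>xs. xs @ [x]) id"
  have "finite (pverts ?P)"
    using G P H by (simp add: relabel_def)
  then obtain S where S: "independent_set ?P S" "card S = independence_number ?P"
    by (rule independence_number_attained)
  have "S \<subseteq> pverts ?P"
    using S by (simp add: independent_set_def)
  also have "pverts ?P = (\<Union>x\<in>pverts G. ?f x ` pverts ?Q)"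
    by (force simp: relabel_def)
  finally have "S = (\<Union>x\<in>pverts G. S \<inter> ?f x ` pverts ?Q)"
    by auto
  then have "card S \<le> (\<Sum>x\<in>pverts G. card (S \<inter> ?f x ` pverts ?Q))"
    using card_UN_le [OF G] by metis
  also have "\<dots> \<le> (\<Sum>x\<in>pverts G. independence_number ?Q)"
  proof (intro sum_mono card_independent_set_Int_image_le [OF S(1)])
    fix x u v
    assume x: "x \<in> pverts G" and uv: "(u, v) \<in> parcs ?Q"
    obtain us y vs z where eq: "u = (us, y)" "v = (vs, z)"
      by (cases u; cases v)
    have "us @ [x] \<in> pverts (cart_power G (Suc m))" "vs @ [x] \<in> pverts (cart_power G (Suc m))"
      using x uv by (auto simp: eq relabel_def)
    moreover have "(us @ [x], vs @ [x]) \<in> parcs (cart_power G (Suc m))"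
      if "(us, vs) \<in> parcs (cart_power G m)"
    proof -
      \<comment> \<open>Arcs of the next power are images of product arcs under appending, so the
        arc is first built on pairs.\<close>
      have "((us, x), (vs, x)) \<in> parcs (cart_power G m \<box> G)"
        using x uv that by (simp add: eq)
      then show ?thesis
        by (auto simp: relabel_def simp del: cart_prod_simps intro: rev_image_eqI)
    qed
    ultimately show "(?f x u, ?f x v) \<in> parcs ?P"
      using uv by (auto simp: eq simp del: cart_power.simps)
  qed (use P H in simp)
  finally show ?thesis
    using S(2) by simp
qed

theorem theorem1p3:
  fixes G :: "'a pair_pre_digraph" and k l :: nat
  assumes "k \<ge> 1" and "l \<ge> 1"
    and "pair_graph G"
    and "\<exists>S. is_clique G S \<and> card S = k"
  shows "ultimate_independence_ratio G
           \<le> real (independence_number (cart_power G l \<box> complete_graph k))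
               / (real k * real (card (pverts G)) ^ l) \<and>
         (\<lambda>n. real (independence_number (cart_power G n \<box> complete_graph k))
               / (real k * real (card (pverts G)) ^ n))
           \<longlonglongrightarrow> ultimate_independence_ratio G"
proof -
  interpret G: pair_graph G by fact
  obtain C where C: "is_clique G C" "card C = k"
    using assms(4) by auto
  define n where "n = card (pverts G)"
  define i where "i m = independence_ratio (cart_power G m)" for m
  define A where "A m = independence_number (cart_power G m \<box> complete_graph k)" for m
  define a where "a m = real (A m) / (real k * real n ^ m)" for m
  define L where "L = ultimate_independence_ratio G"
  have fin: "finite (pverts (cart_power G m))" for m
  proof -
    interpret P: pair_graph "cart_power G m"
      by (rule pair_graph_cart_power) fact
    show ?thesis
      by (rule P.pair_finite_verts)
  qed
  have finK: "finite (pverts (complete_graph k))"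
    by (simp add: complete_graph_def)
  \<comment> \<open>The clique forces \<open>1 \<le> k \<le> n\<close>, so all denominators below
    are positive.\<close>
  have "k \<le> n"
    using C by (auto simp: n_def is_clique_def intro: card_mono)
  then have pos: "real k > 0" "real n > 0"
    using assms(1) by auto
  have i_eq: "i m = real (independence_number (cart_power G m)) / real n ^ m" for m
    by (simp add: i_def independence_ratio_def card_cart_power n_def)
  have i_lim: "i \<longlonglongrightarrow> L"
    using independence_ratio_convergent [OF assms(3)]
    by (simp add: L_def ultimate_independence_ratio_def i_def [abs_def] convergent_LIMSEQ_iff)

  have upper: "a m \<le> i m" for m
  proof -
    have "A m \<le> independence_number (cart_power G m) * k"
      using independence_number_cart_prod_le [OF fin finK]
      by (simp add: A_def complete_graph_def)
    then have "real (A m) \<le> real (independence_number (cart_power G m)) * real k"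
      by (metis of_nat_le_iff of_nat_mult)
    then show ?thesis
      using pos by (simp add: a_def i_eq field_simps)
  qed
  have lower: "i m - n / k * (i m - i (Suc m)) \<le> a m" for m
  proof -
    let ?\<alpha> = "\<lambda>m. independence_number (cart_power G m)"
    have "?\<alpha> (Suc m) \<le> A m + (n - k) * ?\<alpha> m"
      using independence_number_cart_prod_clique_le [OF fin G.pair_finite_verts C]
      by (simp add: A_def n_def independence_number_relabel inj_snoc)
    then have "real (?\<alpha> (Suc m)) \<le> real (A m + (n - k) * ?\<alpha> m)"
      by (simp only: of_nat_le_iff)
    \<comment> \<open>The truncated subtraction \<open>n - k\<close> agrees with the real one
      because \<open>k \<le> n\<close>.\<close>
    also have "\<dots> = real (A m) + (real n - real k) * real (?\<alpha> m)"
      using \<open>k \<le> n\<close> by (simp add: of_nat_diff)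
    finally have *: "real (?\<alpha> (Suc m)) \<le> real (A m) + (real n - real k) * real (?\<alpha> m)" .
    have "i m - n / k * (i m - i (Suc m))
        = (real (?\<alpha> (Suc m)) - (real n - real k) * real (?\<alpha> m)) / (real k * real n ^ m)"
      using pos by (simp add: i_eq field_simps del: cart_power.simps)
    also have "\<dots> \<le> a m"
      unfolding a_def using * pos by (intro divide_right_mono) (auto simp del: cart_power.simps)
    finally show ?thesis .
  qed
  \<comment> \<open>Consecutive terms of \<open>i\<close> share the limit \<open>L\<close>, so the
    correction term vanishes and both bounds on \<open>a\<close> tend to \<open>L\<close>.\<close>
  have "(\<lambda>m. i m - n / k * (i m - i (Suc m))) \<longlonglongrightarrow> L - n / k * (L - L)"
    by (intro tendsto_intros i_lim LIMSEQ_Suc)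
  then have a_lim: "a \<longlonglongrightarrow> L"
    using tendsto_sandwich [of "\<lambda>m. i m - n / k * (i m - i (Suc m))" a sequentially i L]
      lower upper i_lim by simp
  have "a (Suc m) \<le> a m" for m
  proof -
    have "A (Suc m) \<le> n * A m"
      unfolding A_def n_def
      by (rule independence_number_cart_power_Suc_cart_prod_le [OF G.pair_finite_verts fin finK])
    then have "real (A (Suc m)) \<le> real n * real (A m)"
      by (metis of_nat_le_iff of_nat_mult)
    then show ?thesis
      using pos by (simp add: a_def field_simps)
  qed
  then have "L \<le> a l"
    using decseq_ge [OF decseq_SucI a_lim] by blast
  with a_lim show ?thesis
    by (simp add: a_def [abs_def] A_def n_def L_def)
qed

end
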